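(* Let $\mathbf{k}$ be a commutative ring and $q\in\mathbf{k}$. Let $\delta$ and $\varepsilon$ be two compositions. Then, in $\mathrm{QSym}$, $$\eta_\delta^{(q)}\eta_\varepsilon^{(q)}=\sum (-q)^{\sum_{s=1}^{k}\max\{\ell(\beta_s),\ell(\gamma_s)\}-k}\,(q-1)^{\#\{s\in[k]\,:\,\ell(\beta_s)=\ell(\gamma_s)\}}\;\eta^{(q)}_{(|\beta_1|+|\gamma_1|,\ |\beta_2|+|\gamma_2|,\ \ldots,\ |\beta_k|+|\gamma_k|)},$$ where the sum ranges over all $k\in\mathbb{N}$ and all $k$-tuples $(\beta_1,\ldots,\beta_k)$ and $(\gamma_1,\ldots,\gamma_k)$ of (possibly empty) compositions satisfying - $\beta_1\beta_2\cdots\beta_k=\delta$ and $\gamma_1\gamma_2\cdots\gamma_k=\varepsilon$ (concatenations); - $|\ell(\beta_s)-\ell(\gamma_s)|\le 1$ for all $s\in[k]$; - $\ell(\beta_s)+\ell(\gamma_s)>0$ for all $s\in[k]$.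
   Context: $\mathbb{N}=\{0,1,2,\ldots\}$; for an integer $m$, $[m]=\{1,2,\ldots,m\}$ (empty if $m\le 0$). A composition is a finite tuple $\alpha=(\alpha_1,\ldots,\alpha_k)$ of positive integers; its length is $\ell(\alpha)=k$, its size is $|\alpha|=\alpha_1+\cdots+\alpha_k$. $\mathrm{Comp}$ is the set of all compositions (including the empty one $\varnothing$), and $\mathrm{Comp}_n$ the set of compositions of size $n$. For two compositions $\beta,\gamma$, $\beta\gamma$ denotes their concatenation (the entries of $\beta$ followed by the entries of $\gamma$); this is associative with neutral element $\varnothing$. For $\alpha=(\alpha_1,\ldots,\alpha_k)\in\mathrm{Comp}_n$ set $D(\alpha)=\{\alpha_1+\cdots+\alpha_i \mid i\in[k-1]\}\subseteq[n-1]$. $\mathrm{QSym}$ is the $\mathbf{k}$-algebra of quasisymmetric functions over $\mathbf{k}$: the formal power series $f\in\mathbf{k}[[x_1,x_2,x_3,\ldots]]$ of bounded degree such that for all positive integers $a_1,\ldots,a_\ell$ and all $i_1<\cdots<i_\ell$ and $j_1<\cdots<j_\ell$, the coefficients of $x_{i_1}^{a_1}\cdots x_{i_\ell}^{a_\ell}$ and $x_{j_1}^{a_1}\cdots x_{j_\ell}^{a_\ell}$ in $f$ are equal. For a composition $\alpha=(\alpha_1,\ldots,\alpha_\ell)$, $M_\alpha=\sum_{i_1<i_2<\cdots<i_\ell}x_{i_1}^{\alpha_1}\cdots x_{i_\ell}^{\alpha_\ell}$; these form a $\mathbf{k}$-basis of $\mathrm{QSym}$. Set $r:=q+1$. For $\alpha\in\mathrm{Comp}_n$,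 $$\eta_\alpha^{(q)}=\sum_{\beta\in\mathrm{Comp}_n;\ D(\beta)\subseteq D(\alpha)}r^{\ell(\beta)}M_\beta\in\mathrm{QSym}.$$ The sum in the claim is finite, since the conditions force $k\le\ell(\delta)+\ell(\varepsilon)$. *)

theory Defs
  imports "HOL-Library.Poly_Mapping"
begin

section \<open>Formal power series in countably many variables\<close>

text \<open>
  The variables are indexed by \<^typ>\<open>nat\<close>, so that the variable written x_1 on paper has index 0
  here, and so on. A monomial is its finitely supported exponent function, and a power series is
  its coefficient function on monomials.

  Throughout, the sort \<open>{comm_ring, comm_monoid_mult}\<close> is that of arbitrary commutative
  rings with 1; in contrast to \<^class>\<open>comm_ring_1\<close> it does not exclude the zero ring.
\<close>

type_synonym monom = "nat \<Rightarrow>\<^sub>0 nat"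

typedef 'a mpseries = "UNIV :: (monom \<Rightarrow> 'a) set"
  morphisms coef Mpseries ..

lemma mpseries_eqI: "(\<And>m. coef f m = coef g m) \<Longrightarrow> f = g"
  by (metis coef_inject ext)

lemma coef_Mpseries [simp]: "coef (Mpseries f) = f"
  by (simp add: Mpseries_inverse)

definition splits :: "monom \<Rightarrow> (monom \<times> monom) set" where
  "splits m = {(a, b). a + b = m}"

lemma finite_splits [simp]: "finite (splits m)"
proof -
  let ?K = "Poly_Mapping.keys m"
  let ?N = "Max (Poly_Mapping.lookup m ` ?K)"
  let ?F = "{f. \<forall>i. (i \<in> ?K \<longrightarrow> f i \<in> {..?N}) \<and> (i \<notin> ?K \<longrightarrow> f i = 0)}"
  have "(Poly_Mapping.lookup \<circ> fst) ` splits m \<subseteq> ?F"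
  proof clarsimp
    fix a b i
    assume "(a, b) \<in> splits m"
    then have le: "Poly_Mapping.lookup a i \<le> Poly_Mapping.lookup m i"
      by (auto simp: splits_def lookup_add)
    have "Poly_Mapping.lookup m i \<le> ?N" if "i \<in> ?K"
      using that by (intro Max_ge) auto
    with le show "(i \<in> ?K \<longrightarrow> Poly_Mapping.lookup a i \<le> ?N) \<and>
        (i \<notin> ?K \<longrightarrow> Poly_Mapping.lookup a i = 0)"
      by (auto simp: in_keys_iff intro: order_trans)
  qed
  moreover have "finite ?F"
    by (rule finite_set_of_finite_funs) auto
  ultimately have "finite ((Poly_Mapping.lookup \<circ> fst) ` splits m)"
    by (rule finite_subset)
  moreover have "inj_on (Poly_Mapping.lookup \<circ> fst) (splits m)"
    by (auto simp: inj_on_def splits_def lookup_inject)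
  ultimately show ?thesis
    by (rule finite_imageD)
qed

instantiation mpseries :: (ab_group_add) ab_group_add
begin

definition zero_mpseries :: "'a mpseries" where
  "0 = Mpseries (\<lambda>m. 0)"

definition plus_mpseries :: "'a mpseries \<Rightarrow> 'a mpseries \<Rightarrow> 'a mpseries" where
  "f + g = Mpseries (\<lambda>m. coef f m + coef g m)"

definition uminus_mpseries :: "'a mpseries \<Rightarrow> 'a mpseries" where
  "- f = Mpseries (\<lambda>m. - coef f m)"

definition minus_mpseries :: "'a mpseries \<Rightarrow> 'a mpseries \<Rightarrow> 'a mpseries" where
  "f - g = Mpseries (\<lambda>m. coef f m - coef g m)"

instance
  by standard
    (auto intro!: mpseries_eqI simp: zero_mpseries_def plus_mpseries_def uminus_mpseries_def
      minus_mpseries_def algebra_simps)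

end

lemma coef_zero [simp]: "coef 0 m = 0"
  and coef_plus [simp]: "coef (f + g) m = coef f m + coef g m"
  and coef_uminus [simp]: "coef (- f) m = - coef f m"
  and coef_minus [simp]: "coef (f - g) m = coef f m - coef g m"
  by (simp_all add: zero_mpseries_def plus_mpseries_def uminus_mpseries_def minus_mpseries_def)

lemma coef_sum [simp]: "coef (sum f A) m = (\<Sum>i\<in>A. coef (f i) m)"
  by (induction A rule: infinite_finite_induct) auto

instantiation mpseries :: (comm_ring) comm_ring
begin

definition times_mpseries :: "'a mpseries \<Rightarrow> 'a mpseries \<Rightarrow> 'a mpseries" where
  "f * g = Mpseries (\<lambda>m. \<Sum>(a, b)\<in>splits m. coef f a * coef g b)"

instance
proof
  fix f g h :: "'a mpseries"
  show "f * g * h = f * (g * h)"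
  proof (rule mpseries_eqI)
    fix m
    have "coef (f * g * h) m
        = (\<Sum>((p, c), (a, b))\<in>(SIGMA pc:splits m. splits (fst pc)). coef f a * coef g b * coef h c)"
      by (simp add: times_mpseries_def sum_distrib_right sum.Sigma case_prod_unfold)
    also have "\<dots> = (\<Sum>((a, p), (b, c))\<in>(SIGMA ap:splits m. splits (snd ap)).
                    coef f a * coef g b * coef h c)"
      by (rule sum.reindex_bij_witness[where
            i = "\<lambda>((a, p), (b, c)). ((a + b, c), (a, b))" and
            j = "\<lambda>((p, c), (a, b)). ((a, b + c), (b, c))"])
        (auto simp: splits_def algebra_simps)
    also have "\<dots> = coef (f * (g * h)) m"
      by (simp add: times_mpseries_def sum_distrib_left sum.Sigma case_prod_unfold mult.assoc)
    finally show "coef (f * g * h) m = coef (f * (g * h)) m" .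
  qed
  show "f * g = g * f"
    unfolding times_mpseries_def
    by (rule mpseries_eqI, simp, rule sum.reindex_bij_witness[where i = prod.swap and j = prod.swap])
      (auto simp: splits_def case_prod_unfold add.commute mult.commute)
  show "(f + g) * h = f * h + g * h"
    by (rule mpseries_eqI)
      (simp add: times_mpseries_def sum.distrib case_prod_unfold distrib_right)
qed

end

lemma coef_times: "coef (f * g) m = (\<Sum>(a, b)\<in>splits m. coef f a * coef g b)"
  by (simp add: times_mpseries_def)

definition scale :: "'a::comm_ring \<Rightarrow> 'a mpseries \<Rightarrow> 'a mpseries"  (infixr "\<cdot>" 75) where
  "c \<cdot> f = Mpseries (\<lambda>m. c * coef f m)"

lemma coef_scale [simp]: "coef (c \<cdot> f) m = c * coef f m"
  by (simp add: scale_def)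

section \<open>Compositions\<close>

definition composition :: "nat list \<Rightarrow> bool" where
  "composition \<alpha> \<longleftrightarrow> (\<forall>a\<in>set \<alpha>. 0 < a)"

definition Comp :: "nat \<Rightarrow> nat list set" where
  "Comp n = {\<alpha>. composition \<alpha> \<and> sum_list \<alpha> = n}"

definition D :: "nat list \<Rightarrow> nat set" where
  "D \<alpha> = {sum_list (take i \<alpha>) | i. i \<in> {1..length \<alpha> - 1}}"

lemma composition_length_le: "composition \<alpha> \<Longrightarrow> length \<alpha> \<le> sum_list \<alpha>"
  by (induction \<alpha>) (auto simp: composition_def)

lemma finite_Comp [simp]: "finite (Comp n)"
proof (rule finite_subset)
  show "Comp n \<subseteq> {\<alpha>. set \<alpha> \<subseteq> {..n} \<and> length \<alpha> \<le> n}"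
    using composition_length_le member_le_sum_list by (fastforce simp: Comp_def)
  show "finite {\<alpha>. set \<alpha> \<subseteq> {..n} \<and> length \<alpha> \<le> n}"
    by (rule finite_lists_length_le) simp
qed

section \<open>Quasisymmetric functions\<close>

text \<open>The monomial with exponents \<open>as ! s\<close> at the variables \<open>js ! s\<close>.\<close>

definition xmonom :: "nat list \<Rightarrow> nat list \<Rightarrow> monom" where
  "xmonom js as = sum_list (map2 Poly_Mapping.single js as)"

definition monom_degree :: "monom \<Rightarrow> nat" where
  "monom_degree m = (\<Sum>i\<in>Poly_Mapping.keys m. Poly_Mapping.lookup m i)"

definition QSym :: "'a::zero mpseries set" where
  "QSym = {f. (\<exists>d. \<forall>m. coef f m \<noteq> 0 \<longrightarrow> monom_degree m \<le> d) \<and>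
     (\<forall>as is js. composition as \<and> length is = length as \<and> length js = length as \<and>
        sorted_wrt (<) is \<and> sorted_wrt (<) js \<longrightarrow>
        coef f (xmonom is as) = coef f (xmonom js as))}"

text \<open>
  The infinite formal sum of monomials is taken coefficientwise: the coefficient at \<open>m\<close> collects
  a 1 for each strictly increasing index sequence whose monomial is \<open>m\<close>. For a composition
  \<open>\<alpha>\<close> there is at most one such sequence, by \<open>xmonom_inject\<close> below.
\<close>

definition M :: "nat list \<Rightarrow> 'a::{comm_ring, comm_monoid_mult} mpseries" where
  "M \<alpha> = Mpseries (\<lambda>m. \<Sum>js | length js = length \<alpha> \<and> sorted_wrt (<) js \<and> xmonom js \<alpha> = m. 1)"

definition eta :: "'a::{comm_ring, comm_monoid_mult} \<Rightarrow> nat list \<Rightarrow> 'a mpseries" where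
  "eta q \<alpha> = (\<Sum>\<beta> | \<beta> \<in> Comp (sum_list \<alpha>) \<and> D \<beta> \<subseteq> D \<alpha>. (q + 1) ^ length \<beta> \<cdot> M \<beta>)"

lemma xmonom_Nil [simp]: "xmonom [] as = 0" "xmonom js [] = 0"
  and xmonom_Cons [simp]: "xmonom (j # js) (a # as) = Poly_Mapping.single j a + xmonom js as"
  by (simp_all add: xmonom_def)

lemma keys_add_nat:
  "Poly_Mapping.keys (m + m' :: monom) = Poly_Mapping.keys m \<union> Poly_Mapping.keys m'"
  by (auto simp: in_keys_iff lookup_add)

lemma keys_xmonom:
  assumes "length js = length as" "composition as"
  shows "Poly_Mapping.keys (xmonom js as) = set js"
  using assms by (induction js as rule: list_induct2) (auto simp: keys_add_nat composition_def)

lemma lookup_xmonom: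
  assumes "length js = length as" "distinct js"
  shows "map (Poly_Mapping.lookup (xmonom js as)) js = as"
  using assms
proof (induction js as rule: list_induct2)
  case (Cons j js a as)
  have 1: "Poly_Mapping.lookup (xmonom js as) i = 0" if "i \<notin> set js" for i
    using \<open>length js = length as\<close> that
    by (induction js as rule: list_induct2) (auto simp: lookup_add lookup_single)
  have "map (Poly_Mapping.lookup (xmonom (j # js) (a # as))) js
      = map (Poly_Mapping.lookup (xmonom js as)) js"
    using Cons.prems by (auto simp: lookup_add lookup_single when_def)
  moreover have "Poly_Mapping.lookup (xmonom (j # js) (a # as)) j = a"
    using Cons.prems 1[of j] by (simp add: lookup_add)
  ultimately show ?case
    using Cons by (simp del: xmonom_Cons map_eq_conv)
qed simp

lemma xmonom_inject:
  assumes "composition as" "composition bs" "length is = length as" "length js = length bs"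
    and "sorted_wrt (<) is" "sorted_wrt (<) js"
  shows "xmonom is as = xmonom js bs \<longleftrightarrow> is = js \<and> as = bs"
proof
  assume eq: "xmonom is as = xmonom js bs"
  have dist: "distinct is" "distinct js"
    using assms(5,6) by (simp_all add: strict_sorted_iff)
  have "set is = set js"
    using keys_xmonom[OF assms(3,1)] keys_xmonom[OF assms(4,2)] eq by simp
  then have "is = js"
    using strict_sorted_equal[OF assms(5,6)] by simp
  have "as = map (Poly_Mapping.lookup (xmonom is as)) is"
    by (rule lookup_xmonom[OF assms(3) dist(1), symmetric])
  also have "\<dots> = map (Poly_Mapping.lookup (xmonom js bs)) is"
    by (subst eq) (rule refl)
  also have "\<dots> = map (Poly_Mapping.lookup (xmonom js bs)) js"
    by (subst \<open>is = js\<close>) (rule refl)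
  also have "\<dots> = bs"
    by (rule lookup_xmonom[OF assms(4) dist(2)])
  finally show "is = js \<and> as = bs"
    using \<open>is = js\<close> by (intro conjI)
qed simp

lemma coef_M_xmonom:
  assumes "composition \<alpha>" "composition as" "length js = length as" "sorted_wrt (<) js"
  shows "coef (M \<alpha>) (xmonom js as) = (if as = \<alpha> then 1 else 0)"
proof -
  have "xmonom ks \<alpha> = xmonom js as \<longleftrightarrow> ks = js \<and> as = \<alpha>"
    if "length ks = length \<alpha>" "sorted_wrt (<) ks" for ks
    using xmonom_inject[OF assms(1,2) that(1) assms(3) that(2) assms(4)] by blast
  then have "{ks. length ks = length \<alpha> \<and> sorted_wrt (<) ks \<and> xmonom ks \<alpha> = xmonom js as}
      = {ks. length ks = length \<alpha> \<and> sorted_wrt (<) ks \<and> ks = js \<and> as = \<alpha>}"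
    by blast
  also have "\<dots> = (if as = \<alpha> then {js} else {})"
    using assms(3,4) by auto
  finally show ?thesis
    by (simp add: M_def)
qed

lemma monom_degree_xmonom:
  assumes "length js = length as" "composition as" "distinct js"
  shows "monom_degree (xmonom js as) = sum_list as"
proof -
  have "monom_degree (xmonom js as) = sum_list (map (Poly_Mapping.lookup (xmonom js as)) js)"
    unfolding monom_degree_def keys_xmonom[OF assms(1,2)]
    by (rule sum_list_distinct_conv_sum_set[OF assms(3), symmetric])
  then show ?thesis
    unfolding lookup_xmonom[OF assms(1,3)] .
qed

lemma coef_M_nonzero:
  assumes "composition \<alpha>" "coef (M \<alpha> :: 'a::{comm_ring, comm_monoid_mult} mpseries) m \<noteq> 0"
  shows "monom_degree m = sum_list \<alpha>"
proof -
  from assms(2) obtain js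
    where "js \<in> {js. length js = length \<alpha> \<and> sorted_wrt (<) js \<and> xmonom js \<alpha> = m}"
    unfolding M_def coef_Mpseries by (rule sum.not_neutral_contains_not_neutral)
  then show ?thesis
    using monom_degree_xmonom[of js \<alpha>] assms(1) by (auto simp: strict_sorted_iff)
qed

lemma M_in_QSym:
  assumes "composition \<alpha>"
  shows "M \<alpha> \<in> QSym"
  unfolding QSym_def
proof (intro CollectI conjI exI allI impI)
  show "monom_degree m \<le> sum_list \<alpha>" if "coef (M \<alpha>) m \<noteq> 0" for m
    using coef_M_nonzero[OF assms that] by simp
qed (use assms in \<open>auto simp: coef_M_xmonom\<close>)

lemma eta_in_QSym:
  fixes q :: "'a::{comm_ring, comm_monoid_mult}"
  shows "eta q \<alpha> \<in> QSym"
proof -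
  have "monom_degree m \<le> sum_list \<alpha>" if nz: "coef (eta q \<alpha>) m \<noteq> 0" for m
  proof -
    have "(\<Sum>\<beta> | \<beta> \<in> Comp (sum_list \<alpha>) \<and> D \<beta> \<subseteq> D \<alpha>.
        (q + 1) ^ length \<beta> * coef (M \<beta>) m) \<noteq> 0"
      using nz by (simp add: eta_def)
    then obtain \<beta> where "\<beta> \<in> {\<beta>. \<beta> \<in> Comp (sum_list \<alpha>) \<and> D \<beta> \<subseteq> D \<alpha>}"
        "(q + 1) ^ length \<beta> * coef (M \<beta>) m \<noteq> 0"
      by (rule sum.not_neutral_contains_not_neutral)
    then have "composition \<beta>" "sum_list \<beta> = sum_list \<alpha>" "coef (M \<beta> :: 'a mpseries) m \<noteq> 0"
      by (auto simp: Comp_def)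
    then show ?thesis
      using coef_M_nonzero[where 'a = 'a, of \<beta> m] by simp
  qed
  moreover have "coef (eta q \<alpha>) (xmonom is as) = coef (eta q \<alpha>) (xmonom js as)"
    if "composition as" "length is = length as" "length js = length as"
      "sorted_wrt (<) is" "sorted_wrt (<) js" for as "is" js
    using that by (auto simp: eta_def Comp_def coef_M_xmonom intro!: sum.cong)
  ultimately show ?thesis
    unfolding QSym_def by blast
qed

section \<open>The index set of the product formula\<close>

text \<open>
  An element \<open>(k, \<beta>s, \<gamma>s)\<close> carries the two tuples as lists, with 0-based positions \<open>s < k\<close>.
  By the last condition each maximum of \<open>length (\<beta>s ! s)\<close> and \<open>length (\<gamma>s ! s)\<close> is at least 1, so
  that subtracting \<open>k\<close> from the sum of these maxima does not truncate.
\<close>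

definition factorizations ::
  "nat list \<Rightarrow> nat list \<Rightarrow> (nat \<times> nat list list \<times> nat list list) set" where
  "factorizations \<delta> \<epsilon> = {(k, \<beta>s, \<gamma>s).
     length \<beta>s = k \<and> length \<gamma>s = k \<and>
     (\<forall>s<k. composition (\<beta>s ! s)) \<and> (\<forall>s<k. composition (\<gamma>s ! s)) \<and>
     concat \<beta>s = \<delta> \<and> concat \<gamma>s = \<epsilon> \<and>
     (\<forall>s<k. \<bar>int (length (\<beta>s ! s)) - int (length (\<gamma>s ! s))\<bar> \<le> 1) \<and>
     (\<forall>s<k. length (\<beta>s ! s) + length (\<gamma>s ! s) > 0)}"

lemma finite_factorizations: "finite (factorizations \<delta> \<epsilon>)"
proof -
  define N where "N = length \<delta> + length \<epsilon>"
  define L where "L = {xs :: nat list. set xs \<subseteq> set \<delta> \<union> set \<epsilon> \<and> length xs \<le> N}"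
  define LL where "LL = {xss. set xss \<subseteq> L \<and> length xss \<le> N}"
  have len: "length xs \<le> length (concat xss)" "set xs \<subseteq> set (concat xss)"
    if "xs \<in> set xss" for xs and xss :: "nat list list"
    using that by (induction xss) auto
  have "factorizations \<delta> \<epsilon> \<subseteq> {..N} \<times> LL \<times> LL"
  proof (rule subrelI)
    fix k and bsgs :: "nat list list \<times> nat list list"
    obtain bs gs :: "nat list list" where bsgs: "bsgs = (bs, gs)" by (cases bsgs)
    assume "(k, bsgs) \<in> factorizations \<delta> \<epsilon>"
    with bsgs have *: "(k, bs, gs) \<in> factorizations \<delta> \<epsilon>" by simp
    then have k: "length bs = k" "length gs = k"
      and \<delta>: "concat bs = \<delta>" and \<epsilon>: "concat gs = \<epsilon>"
      and pos: "\<And>s. s < k \<Longrightarrow> 1 \<le> length (bs ! s) + length (gs ! s)"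
      by (simp_all add: factorizations_def Suc_le_eq)
    have "k = (\<Sum>s<k. 1)" by simp
    also have "\<dots> \<le> (\<Sum>s<k. length (bs ! s) + length (gs ! s))"
      by (rule sum_mono) (rule pos, simp)
    also have "\<dots> = length (concat bs) + length (concat gs)"
      by (simp add: k length_concat sum_list_sum_nth sum.distrib atLeast0LessThan)
    finally have "k \<le> N"
      by (simp add: \<delta> \<epsilon> N_def)
    moreover have "set bs \<subseteq> L"
      using len[of _ bs] unfolding \<delta> L_def N_def by (blast intro: trans_le_add1)
    moreover have "set gs \<subseteq> L"
      using len[of _ gs] unfolding \<epsilon> L_def N_def by (blast intro: trans_le_add2)
    ultimately show "(k, bsgs) \<in> {..N} \<times> LL \<times> LL"
      by (simp add: bsgs LL_def k)
  qed
  moreover have "finite L"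
    unfolding L_def by (rule finite_lists_length_le) simp
  then have "finite LL"
    unfolding LL_def by (rule finite_lists_length_le)
  then have "finite ({..N} \<times> LL \<times> LL)"
    by simp
  ultimately show ?thesis
    by (rule finite_subset)
qed

end

theory Submission
  imports Defs
begin

text \<open>
  Write \<open>r = q + 1\<close>, and let \<open>e i\<close> be \<open>1\<close> for \<open>i = 0\<close> and \<open>r\<close> for \<open>i > 0\<close> (\<open>block_coef\<close>).
  The proof compares coefficients of monomials, peeling off the smallest variable.

  The coefficient of \<open>x_1^{a_1} ... x_l^{a_l}\<close> in \<open>eta q \<alpha>\<close> is \<open>r^l\<close> if \<open>\<alpha>\<close> can be cut into \<open>l\<close>
  consecutive nonempty blocks of sizes \<open>a_1, ..., a_l\<close>, and \<open>0\<close> otherwise. So splitting off the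
  smallest variable amounts to cutting off an initial block of \<open>\<alpha>\<close> of length \<open>i\<close>, at the price of a
  factor \<open>e i\<close> (\<open>coef_eta_single_plus\<close>). Consequently, for \<open>\<delta> = \<beta> \<delta>'\<close> and \<open>\<epsilon> = \<gamma> \<epsilon>'\<close>, the
  coefficient of \<open>x^c m\<close> in the product is the sum of \<open>e (length \<beta>) e (length \<gamma>)\<close> times the
  coefficient of \<open>m\<close> in \<open>eta q \<delta>' * eta q \<epsilon>'\<close> over all pairs of cuts with
  \<open>sum \<beta> + sum \<gamma> = c\<close> (\<open>coef_eta_times_single_plus\<close>).

  The right-hand side is a weighted sum over the ways to cut \<open>\<delta>\<close> and \<open>\<epsilon>\<close> simultaneously into
  tiles \<open>(\<beta>_s, \<gamma>_s)\<close>. Its weight is multiplicative, so cutting a tiling in two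
  (\<open>sum_tilings_splits\<close>) shows that it satisfies the same recursion, provided that
  \[ \sum_T wt(T) e(length T) = e(length \<beta>) e(length \<gamma>), \]
  where \<open>T\<close> runs over the tilings of \<open>\<beta>\<close> and \<open>\<gamma>\<close> (\<open>sum_weight_block_coef\<close>). This is where the
  particular weights enter. Their generating function by the two lengths of a tile is
  \<open>w = (x + y + (q - 1) x y) / (1 + q x y)\<close>, and \<open>1 - w = (1 - x) (1 - y) / (1 + q x y)\<close>. Hence the
  total weight of all tilings has generating function \<open>(1 + q x y) / ((1 - x) (1 - y))\<close>: it is \<open>1\<close>
  if one of the two lengths is \<open>0\<close>, and \<open>r\<close> otherwise (\<open>sum_weight_tilings\<close>).
\<close>

section \<open>Coefficients of the eta functions\<close>

text \<open>
  A monomial is built up by multiplying in ever smaller variables; both sides of the product formula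
  are governed by a recursion along this construction.
\<close>

lemma monom_induct [case_names zero single_plus]:
  fixes m :: monom
  assumes zero: "P 0"
    and step: "\<And>j c m. 0 < c \<Longrightarrow> \<forall>i\<in>Poly_Mapping.keys m. j < i \<Longrightarrow> P m \<Longrightarrow>
      P (Poly_Mapping.single j c + m)"
  shows "P m"
proof -
  have "\<forall>m. Poly_Mapping.keys m = K \<longrightarrow> P m" if "finite K" for K
    using that
  proof (induction K rule: finite_linorder_min_induct)
    case empty
    then show ?case using zero by simp
  next
    case (insert j K)
    show ?case
    proof (intro allI impI)
      fix m :: monom assume m: "Poly_Mapping.keys m = insert j K"
      let ?m = "Poly_Mapping.update j 0 m"
      have keys: "Poly_Mapping.keys ?m = K"
        using m insert.hyps by (auto simp: keys_update)
      have "Poly_Mapping.lookup m j > 0"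
        using m by (metis in_keys_iff insertI1 gr0I)
      then have "P (Poly_Mapping.single j (Poly_Mapping.lookup m j) + ?m)"
        using keys insert by (intro step) auto
      also have "Poly_Mapping.single j (Poly_Mapping.lookup m j) + ?m = m"
        by (rule poly_mapping_eqI) (auto simp: lookup_add lookup_update lookup_single when_def)
      finally show "P m" .
    qed
  qed
  from this[OF finite_keys, of m] show ?thesis by blast
qed

lemma monom_eq_xmonom:
  "\<exists>js as. length js = length as \<and> sorted_wrt (<) js \<and> composition as \<and> m = xmonom js as"
proof (induction m rule: monom_induct)
  case zero
  show ?case by (rule exI[of _ "[]"], rule exI[of _ "[]"]) (simp add: composition_def)
next
  case (single_plus j c m)
  then obtain js as where *: "length js = length as" "sorted_wrt (<) js" "composition as"
    "m = xmonom js as" by blast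
  with single_plus.hyps show ?case
    by (intro exI[of _ "j # js"] exI[of _ "c # as"]) (auto simp: keys_xmonom composition_def)
qed

text \<open>
  In contrast to \<open>D \<alpha>\<close>, the trivial sums \<open>0\<close> and \<open>sum_list \<alpha>\<close> are included. This makes the sets
  compatible with concatenation, without a special case for the empty composition.
\<close>

definition partial_sums :: "nat list \<Rightarrow> nat set" where
  "partial_sums \<alpha> = {sum_list (take i \<alpha>) | i. i \<le> length \<alpha>}"

lemma partial_sums_Nil [simp]: "partial_sums [] = {0}"
  by (simp add: partial_sums_def)

lemma partial_sums_Cons: "partial_sums (a # \<alpha>) = insert 0 ((+) a ` partial_sums \<alpha>)"
proof -
  have "partial_sums (a # \<alpha>) = (\<lambda>i. sum_list (take i (a # \<alpha>))) ` {..Suc (length \<alpha>)}"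
    by (auto simp: partial_sums_def)
  also have "{..Suc (length \<alpha>)} = insert 0 (Suc ` {..length \<alpha>})"
    by (rule atMost_Suc_eq_insert_0)
  also have "(\<lambda>i. sum_list (take i (a # \<alpha>))) ` \<dots> =
      insert 0 ((+) a ` (\<lambda>i. sum_list (take i \<alpha>)) ` {..length \<alpha>})"
    by (simp add: image_image)
  also have "(\<lambda>i. sum_list (take i \<alpha>)) ` {..length \<alpha>} = partial_sums \<alpha>"
    by (auto simp: partial_sums_def)
  finally show ?thesis .
qed

lemma zero_in_partial_sums [simp]: "0 \<in> partial_sums \<alpha>"
  by (cases \<alpha>) (simp_all add: partial_sums_Cons)

lemma partial_sums_append:
  "partial_sums (\<alpha> @ \<beta>) = partial_sums \<alpha> \<union> (+) (sum_list \<alpha>) ` partial_sums \<beta>"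
  by (induction \<alpha>) (auto simp: partial_sums_Cons image_Un image_image add.assoc)

lemma partial_sums_le: "x \<in> partial_sums \<alpha> \<Longrightarrow> x \<le> sum_list \<alpha>"
  by (induction \<alpha> arbitrary: x) (auto simp: partial_sums_Cons)

lemma composition_take: "composition \<alpha> \<Longrightarrow> composition (take i \<alpha>)"
  and composition_drop: "composition \<alpha> \<Longrightarrow> composition (drop i \<alpha>)"
  by (auto simp: composition_def dest: in_set_takeD in_set_dropD)

lemma composition_sum_eq_0: "composition \<alpha> \<Longrightarrow> sum_list \<alpha> = 0 \<longleftrightarrow> \<alpha> = []"
  by (cases \<alpha>) (auto simp: composition_def)

lemma sum_list_take_strict_mono:
  assumes "composition \<alpha>" "i < j" "j \<le> length \<alpha>"
  shows "sum_list (take i \<alpha>) < sum_list (take j \<alpha>)"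
proof -
  have "take j \<alpha> = take i \<alpha> @ take (j - i) (drop i \<alpha>)"
    using assms(2) by (metis less_imp_le_nat le_add_diff_inverse take_add)
  moreover have "sum_list (take (j - i) (drop i \<alpha>)) \<noteq> 0"
    using assms composition_sum_eq_0[OF composition_take[OF composition_drop[OF assms(1)]]]
    by auto
  ultimately show ?thesis by (metis gr0I less_add_same_cancel1 sum_list.append)
qed

lemma sum_list_take_inject:
  assumes "composition \<alpha>" "i \<le> length \<alpha>" "j \<le> length \<alpha>"
  shows "sum_list (take i \<alpha>) = sum_list (take j \<alpha>) \<longleftrightarrow> i = j"
  using sum_list_take_strict_mono[OF assms(1), of i j] sum_list_take_strict_mono[OF assms(1), of j i]
    assms(2,3) by (cases i j rule: linorder_cases) auto

lemma D_eq_partial_sums: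
  assumes "composition \<alpha>"
  shows "D \<alpha> = partial_sums \<alpha> - {0, sum_list \<alpha>}"
proof -
  have "sum_list (take i \<alpha>) \<notin> {0, sum_list \<alpha>} \<longleftrightarrow> i \<in> {1..length \<alpha> - 1}"
    if "i \<le> length \<alpha>" for i
    using sum_list_take_inject[OF assms that, of 0]
      sum_list_take_inject[OF assms that, of "length \<alpha>"] that by auto
  then have inner: "i \<in> {1..length \<alpha> - 1} \<longleftrightarrow>
      i \<le> length \<alpha> \<and> sum_list (take i \<alpha>) \<notin> {0, sum_list \<alpha>}" for i
    by (cases "i \<le> length \<alpha>") (blast, auto)
  show ?thesis
    unfolding D_def partial_sums_def inner
    by (intro set_eqI) (auto simp only: mem_Collect_eq Diff_iff)
qed

lemma sum_in_partial_sums [simp]: "sum_list \<alpha> \<in> partial_sums \<alpha>"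
  unfolding partial_sums_def by (intro CollectI exI[of _ "length \<alpha>"]) simp

lemma D_subset_iff:
  assumes "composition \<alpha>" "composition \<beta>" "sum_list \<beta> = sum_list \<alpha>"
  shows "D \<beta> \<subseteq> D \<alpha> \<longleftrightarrow> partial_sums \<beta> \<subseteq> partial_sums \<alpha>"
proof -
  have "sum_list \<alpha> \<in> partial_sums \<alpha>" by simp
  then show ?thesis
    unfolding D_eq_partial_sums[OF assms(1)] D_eq_partial_sums[OF assms(2)] assms(3)
    using zero_in_partial_sums[of \<alpha>] by blast
qed

definition coarsens :: "nat list \<Rightarrow> nat list \<Rightarrow> bool" where
  "coarsens \<beta> \<alpha> \<longleftrightarrow> sum_list \<beta> = sum_list \<alpha> \<and> partial_sums \<beta> \<subseteq> partial_sums \<alpha>"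

text \<open>
  The first entry of a coarsening of \<open>\<alpha>\<close> is the sum of an initial block of \<open>\<alpha>\<close>, and the remaining
  entries coarsen what is left: the partial sums of \<open>\<alpha>\<close> from \<open>c\<close> on are those of
  \<open>drop i \<alpha>\<close>, shifted by \<open>c\<close>.
\<close>

lemma coarsens_Cons:
  "coarsens (c # \<beta>) \<alpha> \<longleftrightarrow> (\<exists>i\<le>length \<alpha>. sum_list (take i \<alpha>) = c \<and> coarsens \<beta> (drop i \<alpha>))"
proof -
  have key: "coarsens (c # \<beta>) \<alpha> \<longleftrightarrow> coarsens \<beta> (drop i \<alpha>)" if "sum_list (take i \<alpha>) = c" for i
  proof -
    have "partial_sums \<alpha> = partial_sums (take i \<alpha>) \<union> (+) c ` partial_sums (drop i \<alpha>)"
      using partial_sums_append[of "take i \<alpha>" "drop i \<alpha>"] that by simp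
    then have "c + x \<in> partial_sums \<alpha> \<longleftrightarrow> x \<in> partial_sums (drop i \<alpha>)" for x
      using partial_sums_le[of "c + x" "take i \<alpha>"] that by auto
    then have "partial_sums (c # \<beta>) \<subseteq> partial_sums \<alpha> \<longleftrightarrow>
        partial_sums \<beta> \<subseteq> partial_sums (drop i \<alpha>)"
      by (auto simp: partial_sums_Cons)
    moreover have "sum_list \<alpha> = c + sum_list (drop i \<alpha>)"
      using that by (metis append_take_drop_id sum_list.append)
    ultimately show ?thesis
      by (simp add: coarsens_def)
  qed
  have "\<exists>i\<le>length \<alpha>. sum_list (take i \<alpha>) = c" if "coarsens (c # \<beta>) \<alpha>"
  proof -
    have "c \<in> partial_sums (c # \<beta>)"
      by (force simp: partial_sums_Cons)
    then show ?thesis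
      using that by (auto simp: coarsens_def partial_sums_def)
  qed
  then show ?thesis using key by blast
qed

lemma coef_eta_xmonom:
  fixes q :: "'a::{comm_ring, comm_monoid_mult}"
  assumes "composition \<alpha>" "composition as" "length js = length as" "sorted_wrt (<) js"
  shows "coef (eta q \<alpha>) (xmonom js as) = (if coarsens as \<alpha> then (q + 1) ^ length as else 0)"
proof -
  let ?B = "{\<beta>. \<beta> \<in> Comp (sum_list \<alpha>) \<and> D \<beta> \<subseteq> D \<alpha>}"
  have "coef (eta q \<alpha>) (xmonom js as) =
      (\<Sum>\<beta>\<in>?B. if \<beta> = as then (q + 1) ^ length as else 0)"
    unfolding eta_def using assms by (auto simp: Comp_def coef_M_xmonom intro!: sum.cong)
  also have "\<dots> = (if as \<in> ?B then (q + 1) ^ length as else 0)"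
    by simp
  also have "as \<in> ?B \<longleftrightarrow> coarsens as \<alpha>"
    using D_subset_iff[OF assms(1,2)] assms(2) by (auto simp: Comp_def coarsens_def)
  finally show ?thesis .
qed

definition block_coef :: "'a::{comm_ring, comm_monoid_mult} \<Rightarrow> nat \<Rightarrow> 'a" where
  "block_coef q i = (if i = 0 then 1 else q + 1)"

lemma coef_eta_zero:
  assumes "composition \<alpha>"
  shows "coef (eta q \<alpha>) 0 = (if \<alpha> = [] then 1 else 0)"
proof -
  have "coarsens [] \<alpha> \<longleftrightarrow> \<alpha> = []"
    using composition_sum_eq_0[OF assms] by (auto simp: coarsens_def)
  then show ?thesis
    using coef_eta_xmonom[OF assms, of "[]" "[]" q] by (simp add: composition_def)
qed

text \<open>
  At most one \<open>i\<close> contributes, since the partial sums of a composition increase strictly. The term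
  \<open>i = 0\<close> covers \<open>c = 0\<close>, where nothing is split off and the factor is \<open>1\<close>; each variable that
  does occur uses up a nonempty block and contributes \<open>q + 1\<close>.
\<close>

lemma coef_eta_single_plus:
  fixes q :: "'a::{comm_ring, comm_monoid_mult}"
  assumes \<alpha>: "composition \<alpha>" and j: "\<forall>i\<in>Poly_Mapping.keys m. j < i"
  shows "coef (eta q \<alpha>) (Poly_Mapping.single j c + m) =
    (\<Sum>i\<le>length \<alpha>. if sum_list (take i \<alpha>) = c
      then block_coef q i * coef (eta q (drop i \<alpha>)) m else 0)"
proof (cases "\<exists>i\<le>length \<alpha>. sum_list (take i \<alpha>) = c")
  case True
  then obtain i where i: "i \<le> length \<alpha>" "sum_list (take i \<alpha>) = c" by blast
  have uniq: "sum_list (take i' \<alpha>) = c \<longleftrightarrow> i' = i" if "i' \<le> length \<alpha>" for i'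
    using sum_list_take_inject[OF \<alpha> that i(1)] i(2) by simp
  have "(\<Sum>i\<le>length \<alpha>. if sum_list (take i \<alpha>) = c
      then block_coef q i * coef (eta q (drop i \<alpha>)) m else 0) =
      (\<Sum>i'\<le>length \<alpha>. if i' = i then block_coef q i' * coef (eta q (drop i' \<alpha>)) m else 0)"
    by (intro sum.cong refl) (simp add: uniq)
  also have "\<dots> = block_coef q i * coef (eta q (drop i \<alpha>)) m"
    using i(1) by simp
  also have "\<dots> = coef (eta q \<alpha>) (Poly_Mapping.single j c + m)"
  proof (cases "i = 0")
    case True
    with i show ?thesis by (simp add: block_coef_def)
  next
    case False
    obtain js as where m: "length js = length as" "sorted_wrt (<) js" "composition as"
      "m = xmonom js as" using monom_eq_xmonom by blast
    have "c > 0"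
      using sum_list_take_strict_mono[OF \<alpha>, of 0 i] False i by simp
    then have "coef (eta q \<alpha>) (xmonom (j # js) (c # as)) =
        (if coarsens (c # as) \<alpha> then (q + 1) ^ length (c # as) else 0)"
      using m j by (intro coef_eta_xmonom \<alpha>) (auto simp: composition_def keys_xmonom)
    moreover have "coarsens (c # as) \<alpha> \<longleftrightarrow> coarsens as (drop i \<alpha>)"
      unfolding coarsens_Cons using i uniq by blast
    moreover have "coef (eta q (drop i \<alpha>)) m =
        (if coarsens as (drop i \<alpha>) then (q + 1) ^ length as else 0)"
      unfolding m(4) by (intro coef_eta_xmonom composition_drop \<alpha> m)
    ultimately show ?thesis
      using False by (simp add: block_coef_def m(4))
  qed
  finally show ?thesis by simp
next
  case False
  then have "c \<noteq> 0" by (metis sum_list.Nil take_0 zero_le)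
  obtain js as where m: "length js = length as" "sorted_wrt (<) js" "composition as"
    "m = xmonom js as" using monom_eq_xmonom by blast
  have "coef (eta q \<alpha>) (xmonom (j # js) (c # as)) =
      (if coarsens (c # as) \<alpha> then (q + 1) ^ length (c # as) else 0)"
    using m j \<open>c \<noteq> 0\<close> by (intro coef_eta_xmonom \<alpha>) (auto simp: composition_def keys_xmonom)
  moreover have "\<not> coarsens (c # as) \<alpha>"
    using False by (auto simp: coarsens_Cons)
  moreover have "(\<Sum>i\<le>length \<alpha>. if sum_list (take i \<alpha>) = c
      then block_coef q i * coef (eta q (drop i \<alpha>)) m else 0) = 0"
    using False by (intro sum.neutral) auto
  ultimately show ?thesis by (simp add: m(4))
qed

section \<open>Coefficients of products\<close>

text \<open>
  A factorization of \<open>x_j^c m\<close> distributes the exponent \<open>c\<close> of \<open>x_j\<close> and factors \<open>m\<close>,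
  independently.
\<close>

lemma coef_times_single_plus:
  assumes "j \<notin> Poly_Mapping.keys m"
  shows "coef (f * g) (Poly_Mapping.single j c + m) =
    (\<Sum>c'\<le>c. \<Sum>(a, b)\<in>splits m.
      coef f (Poly_Mapping.single j c' + a) * coef g (Poly_Mapping.single j (c - c') + b))"
proof -
  have mj: "Poly_Mapping.lookup m j = 0"
    using assms by (simp add: in_keys_iff)
  have split: "Poly_Mapping.single j (Poly_Mapping.lookup a j) + Poly_Mapping.update j 0 a = a"
    for a :: monom
    by (rule poly_mapping_eqI) (auto simp: lookup_add lookup_update lookup_single when_def)
  have upd: "Poly_Mapping.update j 0 (Poly_Mapping.single j k + a) = a"
    if "Poly_Mapping.lookup a j = 0" for a :: monom and k
    using that by (intro poly_mapping_eqI)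
      (auto simp: lookup_add lookup_update lookup_single when_def)
  have upd_add: "Poly_Mapping.update j 0 (a + b) =
      Poly_Mapping.update j 0 a + Poly_Mapping.update j 0 b" for a b :: monom
    by (rule poly_mapping_eqI) (auto simp: lookup_add lookup_update)
  have "coef (f * g) (Poly_Mapping.single j c + m) =
      (\<Sum>(c', a, b)\<in>{..c} \<times> splits m.
        coef f (Poly_Mapping.single j c' + a) * coef g (Poly_Mapping.single j (c - c') + b))"
    unfolding coef_times
  proof (rule sum.reindex_bij_witness[where
      i = "\<lambda>(c', a, b). (Poly_Mapping.single j c' + a, Poly_Mapping.single j (c - c') + b)" and
      j = "\<lambda>(a, b). (Poly_Mapping.lookup a j, Poly_Mapping.update j 0 a, Poly_Mapping.update j 0 b)"],
      goal_cases)
    case (1 p)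
    then obtain a b where p: "p = (a, b)" "a + b = Poly_Mapping.single j c + m"
      by (auto simp: splits_def)
    have "Poly_Mapping.lookup a j + Poly_Mapping.lookup b j = c"
      using arg_cong[OF p(2), of "\<lambda>x. Poly_Mapping.lookup x j"] mj by (simp add: lookup_add)
    then have "c - Poly_Mapping.lookup a j = Poly_Mapping.lookup b j" by simp
    then show ?case by (simp add: p(1) split)
  next
    case (2 p)
    then obtain a b where p: "p = (a, b)" "a + b = Poly_Mapping.single j c + m"
      by (auto simp: splits_def)
    have "Poly_Mapping.lookup a j + Poly_Mapping.lookup b j = c"
      using arg_cong[OF p(2), of "\<lambda>x. Poly_Mapping.lookup x j"] mj by (simp add: lookup_add)
    moreover have "Poly_Mapping.update j 0 a + Poly_Mapping.update j 0 b = m"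
      using p(2) upd_add[of a b] upd[OF mj] by simp
    ultimately show ?case by (simp add: p(1) splits_def)
  next
    case (3 p)
    then obtain c' a b where p: "p = (c', a, b)" "c' \<le> c" "a + b = m"
      by (auto simp: splits_def)
    then have "Poly_Mapping.lookup a j = 0" "Poly_Mapping.lookup b j = 0"
      using mj by (auto simp: lookup_add)
    then show ?case by (simp add: p(1) upd lookup_add)
  next
    case (4 p)
    then obtain c' a b where p: "p = (c', a, b)" "c' \<le> c" "a + b = m"
      by (auto simp: splits_def)
    then have "Poly_Mapping.single j c' + a + (Poly_Mapping.single j (c - c') + b) =
        (Poly_Mapping.single j c' + Poly_Mapping.single j (c - c')) + m"
      unfolding p(3)[symmetric] by (simp only: ac_simps)
    also have "\<dots> = Poly_Mapping.single j c + m"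
      using p(2) by (simp flip: single_add)
    finally show ?case by (simp add: p(1) splits_def)
  next
    case (5 p)
    then obtain a b where p: "p = (a, b)" "a + b = Poly_Mapping.single j c + m"
      by (auto simp: splits_def)
    have "Poly_Mapping.lookup a j + Poly_Mapping.lookup b j = c"
      using arg_cong[OF p(2), of "\<lambda>x. Poly_Mapping.lookup x j"] mj by (simp add: lookup_add)
    then have "c - Poly_Mapping.lookup a j = Poly_Mapping.lookup b j" by simp
    then show ?case by (simp add: p(1) split)
  qed
  also have "\<dots> = (\<Sum>c'\<le>c. \<Sum>(a, b)\<in>splits m.
      coef f (Poly_Mapping.single j c' + a) * coef g (Poly_Mapping.single j (c - c') + b))"
    by (subst sum.cartesian_product) simp
  finally show ?thesis .
qed

lemma coef_eta_times_zero:
  assumes "composition \<delta>" "composition \<epsilon>"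
  shows "coef (eta q \<delta> * eta q \<epsilon>) 0 = (if \<delta> = [] \<and> \<epsilon> = [] then 1 else 0)"
proof -
  have "splits 0 = {(0, 0)}"
    by (auto simp: splits_def poly_mapping_eq_iff fun_eq_iff lookup_add)
  then show ?thesis
    using assms by (simp add: coef_times coef_eta_zero)
qed

lemma coef_eta_times_single_plus:
  fixes q :: "'a::{comm_ring, comm_monoid_mult}"
  assumes \<delta>: "composition \<delta>" and \<epsilon>: "composition \<epsilon>"
    and j: "\<forall>i\<in>Poly_Mapping.keys m. j < i"
  shows "coef (eta q \<delta> * eta q \<epsilon>) (Poly_Mapping.single j c + m) =
    (\<Sum>i\<le>length \<delta>. \<Sum>k\<le>length \<epsilon>.
      if sum_list (take i \<delta>) + sum_list (take k \<epsilon>) = c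
      then block_coef q i * block_coef q k * coef (eta q (drop i \<delta>) * eta q (drop k \<epsilon>)) m
      else 0)"
proof -
  define s t where "s i = sum_list (take i \<delta>)" and "t k = sum_list (take k \<epsilon>)" for i k
  define X where "X i k a b = block_coef q i * block_coef q k *
    (coef (eta q (drop i \<delta>)) a * coef (eta q (drop k \<epsilon>)) b)" for i k a b
  have summand: "coef (eta q \<delta>) (Poly_Mapping.single j c' + a) *
      coef (eta q \<epsilon>) (Poly_Mapping.single j (c - c') + b) =
      (\<Sum>i\<le>length \<delta>. \<Sum>k\<le>length \<epsilon>. if s i = c' \<and> t k = c - c' then X i k a b else 0)"
    if "(a, b) \<in> splits m" for c' a b
  proof -
    have ab: "\<forall>i\<in>Poly_Mapping.keys a. j < i" "\<forall>i\<in>Poly_Mapping.keys b. j < i"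
      using that j by (auto simp: splits_def keys_add_nat)
    show ?thesis
      unfolding coef_eta_single_plus[OF \<delta> ab(1)] coef_eta_single_plus[OF \<epsilon> ab(2)] sum_product
      by (intro sum.cong refl) (auto simp: X_def s_def t_def ac_simps)
  qed
  have "j \<notin> Poly_Mapping.keys m" using j by blast
  then have "coef (eta q \<delta> * eta q \<epsilon>) (Poly_Mapping.single j c + m) =
      (\<Sum>c'\<le>c. \<Sum>(a, b)\<in>splits m. \<Sum>i\<le>length \<delta>. \<Sum>k\<le>length \<epsilon>.
        if s i = c' \<and> t k = c - c' then X i k a b else 0)"
    unfolding coef_times_single_plus[OF \<open>j \<notin> _\<close>] by (intro sum.cong refl) (auto simp: summand)
  also have "\<dots> = (\<Sum>i\<le>length \<delta>. \<Sum>k\<le>length \<epsilon>. \<Sum>(a, b)\<in>splits m. \<Sum>c'\<le>c.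
        if s i = c' \<and> t k = c - c' then X i k a b else 0)"
    unfolding case_prod_unfold
    by (simp only: sum.swap[of _ "splits m" "{..length \<delta>}"]
        sum.swap[of _ "splits m" "{..length \<epsilon>}"] sum.swap[of _ "{..c}" "{..length \<delta>}"]
        sum.swap[of _ "{..c}" "{..length \<epsilon>}"] sum.swap[of _ "{..c}" "splits m"])
  also have "\<dots> = (\<Sum>i\<le>length \<delta>. \<Sum>k\<le>length \<epsilon>. if s i + t k = c
      then \<Sum>(a, b)\<in>splits m. X i k a b else 0)"
  proof (intro sum.cong refl)
    fix i k
    have "(\<Sum>c'\<le>c. if s i = c' \<and> t k = c - c' then X i k a b else 0) =
        (if s i + t k = c then X i k a b else 0)" for a b
    proof -
      have "(\<Sum>c'\<le>c. if s i = c' \<and> t k = c - c' then X i k a b else 0) =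
          (\<Sum>c'\<le>c. if s i = c' then (if s i + t k = c then X i k a b else 0) else 0)"
        by (intro sum.cong refl) auto
      then show ?thesis by simp
    qed
    then show "(\<Sum>(a, b)\<in>splits m. \<Sum>c'\<le>c. if s i = c' \<and> t k = c - c' then X i k a b else 0) =
        (if s i + t k = c then \<Sum>(a, b)\<in>splits m. X i k a b else 0)"
      by simp
  qed
  also have "\<dots> = (\<Sum>i\<le>length \<delta>. \<Sum>k\<le>length \<epsilon>. if s i + t k = c
      then block_coef q i * block_coef q k * coef (eta q (drop i \<delta>) * eta q (drop k \<epsilon>)) m else 0)"
    unfolding X_def coef_times sum_distrib_left case_prod_unfold by (rule refl)
  finally show ?thesis by (simp only: s_def t_def)
qed

section \<open>Joint tilings of two compositions\<close>

definition admissible :: "'b list \<times> 'c list \<Rightarrow> bool" where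
  "admissible = (\<lambda>(\<beta>, \<gamma>). \<bar>int (length \<beta>) - int (length \<gamma>)\<bar> \<le> 1 \<and> 0 < length \<beta> + length \<gamma>)"

text \<open>
  A tiling is a list of pairs \<open>(\<beta>_s, \<gamma>_s)\<close>; unlike the triples in \<open>factorizations\<close>, such lists can
  be concatenated and cut.
\<close>

definition tilings :: "'b list \<Rightarrow> 'c list \<Rightarrow> ('b list \<times> 'c list) list set" where
  "tilings \<delta> \<epsilon> = {ps. concat (map fst ps) = \<delta> \<and> concat (map snd ps) = \<epsilon> \<and> (\<forall>p\<in>set ps. admissible p)}"

text \<open>
  The value \<open>0\<close> outside the admissible lengths allows sums over tiles to range over full
  rectangles of lengths.
\<close>

definition tile_weight :: "'a::{comm_ring, comm_monoid_mult} \<Rightarrow> nat \<Rightarrow> nat \<Rightarrow> 'a" where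
  "tile_weight q i k = (if \<bar>int i - int k\<bar> \<le> 1 \<and> 0 < i + k
     then (- q) ^ (max i k - 1) * (if i = k then q - 1 else 1) else 0)"

definition weight :: "'a::{comm_ring, comm_monoid_mult} \<Rightarrow> ('b list \<times> 'c list) list \<Rightarrow> 'a" where
  "weight q ps = (\<Prod>(\<beta>, \<gamma>)\<leftarrow>ps. tile_weight q (length \<beta>) (length \<gamma>))"

lemma weight_Nil [simp]: "weight q [] = 1"
  and weight_Cons [simp]:
    "weight q ((\<beta>, \<gamma>) # ps) = tile_weight q (length \<beta>) (length \<gamma>) * weight q ps"
  and weight_append: "weight q (ps @ ps') = weight q ps * weight q ps'"
  by (simp_all add: weight_def)

lemma finite_tilings [simp]: "finite (tilings \<delta> \<epsilon>)"
proof (induction "length \<delta> + length \<epsilon>" arbitrary: \<delta> \<epsilon> rule: less_induct)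
  case less
  let ?I = "{(i, k). i \<le> length \<delta> \<and> k \<le> length \<epsilon> \<and> 0 < i + k}"
  have "tilings \<delta> \<epsilon> \<subseteq> insert [] (\<Union>(i, k)\<in>?I.
      (#) (take i \<delta>, take k \<epsilon>) ` tilings (drop i \<delta>) (drop k \<epsilon>))"
  proof
    fix ps assume ps: "ps \<in> tilings \<delta> \<epsilon>"
    show "ps \<in> insert [] (\<Union>(i, k)\<in>?I.
      (#) (take i \<delta>, take k \<epsilon>) ` tilings (drop i \<delta>) (drop k \<epsilon>))"
    proof (cases ps)
      case (Cons p qs)
      obtain \<beta> \<gamma> where p: "p = (\<beta>, \<gamma>)" by fastforce
      from ps Cons p have "(length \<beta>, length \<gamma>) \<in> ?I"
        "ps \<in> (#) (take (length \<beta>) \<delta>, take (length \<gamma>) \<epsilon>) `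
          tilings (drop (length \<beta>) \<delta>) (drop (length \<gamma>) \<epsilon>)"
        by (auto simp: tilings_def admissible_def)
      then show ?thesis by blast
    qed simp
  qed
  moreover have "finite ?I"
    by (rule finite_subset[of _ "{..length \<delta>} \<times> {..length \<epsilon>}"]) auto
  then have "finite (insert [] (\<Union>(i, k)\<in>?I.
      (#) (take i \<delta>, take k \<epsilon>) ` tilings (drop i \<delta>) (drop k \<epsilon>)))"
    using less by auto
  ultimately show ?case by (rule finite_subset)
qed

lemma tilings_eq_Nil_iff: "[] \<in> tilings \<delta> \<epsilon> \<longleftrightarrow> \<delta> = [] \<and> \<epsilon> = []"
  by (auto simp: tilings_def)

lemma tilings_Nil [simp]: "tilings ([] :: 'b list) ([] :: 'c list) = {[]}"
proof -
  have "ps = []" if "ps \<in> tilings [] []" for ps :: "('b list \<times> 'c list) list"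
    using that by (cases ps) (auto simp: tilings_def admissible_def)
  then show ?thesis by (auto simp: tilings_eq_Nil_iff)
qed

text \<open>
  Cutting a tiling after \<open>n\<close> tiles cuts \<open>\<delta>\<close> and \<open>\<epsilon>\<close> after as many entries as these tiles cover;
  conversely, tilings of the two halves can be joined.
\<close>

lemma sum_tilings_splits:
  fixes h :: "('b list \<times> 'c list) list \<Rightarrow> ('b list \<times> 'c list) list \<Rightarrow> 'a::comm_monoid_add"
  shows "(\<Sum>ps\<in>tilings \<delta> \<epsilon>. \<Sum>n\<le>length ps. h (take n ps) (drop n ps)) =
    (\<Sum>i\<le>length \<delta>. \<Sum>k\<le>length \<epsilon>. \<Sum>ps\<in>tilings (take i \<delta>) (take k \<epsilon>).
      \<Sum>ps'\<in>tilings (drop i \<delta>) (drop k \<epsilon>). h ps ps')"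
proof -
  let ?T = "\<lambda>(i, k). tilings (take i \<delta>) (take k \<epsilon>) \<times> tilings (drop i \<delta>) (drop k \<epsilon>)"
  let ?j = "\<lambda>(ps, n). ((length (concat (map fst (take n ps))), length (concat (map snd (take n ps)))),
    (take n ps, drop n ps))"
  have cut: "?j (ps, n) \<in> Sigma ({..length \<delta>} \<times> {..length \<epsilon>}) ?T"
    if "ps \<in> tilings \<delta> \<epsilon>" for ps n
  proof -
    obtain xs ys where ps: "ps = xs @ ys" "take n ps = xs" "drop n ps = ys"
      by (metis append_take_drop_id)
    show ?thesis
      unfolding prod.case ps(2,3) using that ps(1) by (auto simp: tilings_def)
  qed
  have "(\<Sum>ps\<in>tilings \<delta> \<epsilon>. \<Sum>n\<le>length ps. h (take n ps) (drop n ps)) =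
      (\<Sum>(ps, n)\<in>(SIGMA ps:tilings \<delta> \<epsilon>. {..length ps}). h (take n ps) (drop n ps))"
    by (rule sum.Sigma) auto
  also have "\<dots> = (\<Sum>(_, ps, ps')\<in>Sigma ({..length \<delta>} \<times> {..length \<epsilon>}) ?T. h ps ps')"
  proof (rule sum.reindex_bij_witness[where i = "\<lambda>(_, ps, ps'). (ps @ ps', length ps)" and j = ?j],
      goal_cases)
    case (2 x)
    then show ?case using cut by (cases x) auto
  next
    case (3 y)
    then obtain i k ps ps' where y: "y = ((i, k), (ps, ps'))" "i \<le> length \<delta>" "k \<le> length \<epsilon>"
      "ps \<in> tilings (take i \<delta>) (take k \<epsilon>)" by auto
    then have "length (concat (map fst ps)) = i" "length (concat (map snd ps)) = k"
      by (simp_all add: tilings_def)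
    then show ?case by (simp add: y(1))
  next
    case (4 y)
    then obtain i k ps ps' where y: "y = ((i, k), (ps, ps'))"
      "ps \<in> tilings (take i \<delta>) (take k \<epsilon>)" "ps' \<in> tilings (drop i \<delta>) (drop k \<epsilon>)" by auto
    then have "ps @ ps' \<in> tilings \<delta> \<epsilon>"
      by (auto simp: tilings_def)
    then show ?case by (simp add: y(1))
  qed auto
  also have "\<dots> = (\<Sum>p\<in>{..length \<delta>} \<times> {..length \<epsilon>}. \<Sum>(ps, ps')\<in>?T p. h ps ps')"
    by (rule sum.Sigma[symmetric]) auto
  also have "\<dots> = (\<Sum>i\<le>length \<delta>. \<Sum>k\<le>length \<epsilon>. \<Sum>ps\<in>tilings (take i \<delta>) (take k \<epsilon>).
      \<Sum>ps'\<in>tilings (drop i \<delta>) (drop k \<epsilon>). h ps ps')"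
    by (simp add: sum.cartesian_product case_prod_unfold)
  finally show ?thesis .
qed

section \<open>The total weight of all tilings\<close>

text \<open>
  The coefficients of \<open>(1 + q x y) / ((1 - x) (1 - y))\<close>.
\<close>

definition total_weight :: "'a::{comm_ring, comm_monoid_mult} \<Rightarrow> nat \<Rightarrow> nat \<Rightarrow> 'a" where
  "total_weight q a b = (if a = 0 \<or> b = 0 then 1 else q + 1)"

lemma tile_weight_simps [simp]:
  "tile_weight q 0 0 = 0"
  "tile_weight q 0 (Suc k) = (if k = 0 then 1 else 0)"
  "tile_weight q (Suc i) 0 = (if i = 0 then 1 else 0)"
  by (auto simp: tile_weight_def)

text \<open>
  This is \<open>(1 + q x y) w = x + y + (q - 1) x y\<close> for the generating function \<open>w\<close> of the tile weights,
  read off at a monomial divisible by \<open>x y\<close>.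
\<close>

lemma tile_weight_Suc_Suc:
  "tile_weight q (Suc i) (Suc k) = (if i = 0 \<and> k = 0 then q - 1 else 0) - q * tile_weight q i k"
proof (cases "i = 0 \<and> k = 0")
  case False
  then obtain n where "max i k = Suc n"
    by (metis max_0L max_0R not0_implies_Suc max.commute max_nat.eq_neutr_iff)
  with False show ?thesis
    by (auto simp: tile_weight_def mult.assoc)
qed (simp add: tile_weight_def)

text \<open>
  In terms of generating functions, \<open>w W = W - 1\<close> for \<open>W = 1 / (1 - w)\<close>. The induction step removes
  one from both lengths. The two boundary lines \<open>i = 0\<close> and \<open>k = 0\<close> contribute a single tile each,
  and by \<open>tile_weight_Suc_Suc\<close> the interior is \<open>- q\<close> times the previous sum, up to the correction at
  the tile of lengths \<open>(1, 1)\<close>.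
\<close>

lemma sum_tile_weight:
  fixes q :: "'a::{comm_ring, comm_monoid_mult}"
  shows "(\<Sum>i\<le>a. \<Sum>k\<le>b. tile_weight q i k * total_weight q (a - i) (b - k)) =
    total_weight q a b - (if a = 0 \<and> b = 0 then 1 else 0)"
proof (induction a arbitrary: b)
  case 0
  show ?case
    by (cases b) (simp_all add: total_weight_def sum.atMost_Suc_shift del: sum.atMost_Suc)
next
  case (Suc a)
  note shift = sum.atMost_Suc_shift
  show ?case
  proof (cases b)
    case 0
    then show ?thesis
      by (simp add: total_weight_def shift del: sum.atMost_Suc)
  next
    case (Suc b')
    let ?G = "total_weight q"
    have delta: "(\<Sum>k\<le>b'. if i = 0 \<and> k = 0 then x else 0) = (if i = 0 then x else 0)"
      for i :: nat and x :: 'a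
      by (cases "i = 0") simp_all
    have "(\<Sum>i\<le>Suc a. \<Sum>k\<le>b. tile_weight q i k * ?G (Suc a - i) (b - k)) =
        ?G (Suc a) b' + ?G a (Suc b') +
        (\<Sum>i\<le>a. \<Sum>k\<le>b'. tile_weight q (Suc i) (Suc k) * ?G (a - i) (b' - k))"
      by (simp add: Suc shift sum.distrib total_weight_def if_distrib[of "\<lambda>x. x * _"] cong: if_cong
          del: sum.atMost_Suc)
    also have "(\<Sum>i\<le>a. \<Sum>k\<le>b'. tile_weight q (Suc i) (Suc k) * ?G (a - i) (b' - k)) =
        (\<Sum>i\<le>a. \<Sum>k\<le>b'. if i = 0 \<and> k = 0 then (q - 1) * ?G a b' else 0) -
        q * (\<Sum>i\<le>a. \<Sum>k\<le>b'. tile_weight q i k * ?G (a - i) (b' - k))"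
      unfolding tile_weight_Suc_Suc sum_distrib_left sum_subtractf[symmetric]
      by (intro sum.cong refl) (auto simp: algebra_simps)
    also have "(\<Sum>i\<le>a. \<Sum>k\<le>b'. if i = 0 \<and> k = 0 then (q - 1) * ?G a b' else 0) =
        (q - 1) * ?G a b'"
      by (simp add: delta)
    also note Suc.IH
    also have "?G (Suc a) b' + ?G a (Suc b') +
        ((q - 1) * ?G a b' - q * (?G a b' - (if a = 0 \<and> b' = 0 then 1 else 0))) =
        ?G (Suc a) (Suc b')"
      by (auto simp: total_weight_def algebra_simps)
    finally show ?thesis using Suc by simp
  qed
qed

text \<open>
  The first tile is removed: in the splitting identity for tilings, only cuts after exactly one tile
  are counted.
\<close>

lemma sum_weight_tilings_rec:
  fixes \<delta> :: "'b list" and \<epsilon> :: "'c list"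
  assumes "\<delta> \<noteq> [] \<or> \<epsilon> \<noteq> []"
  shows "(\<Sum>ps\<in>tilings \<delta> \<epsilon>. weight q ps) =
    (\<Sum>i\<le>length \<delta>. \<Sum>k\<le>length \<epsilon>. tile_weight q i k *
      (\<Sum>ps\<in>tilings (drop i \<delta>) (drop k \<epsilon>). weight q ps))"
proof -
  define h where "h ps ps' = (if length ps = 1 then weight q ps * weight q ps' else 0)"
    for ps ps' :: "('b list \<times> 'c list) list"
  have "(\<Sum>ps\<in>tilings \<delta> \<epsilon>. weight q ps) =
      (\<Sum>ps\<in>tilings \<delta> \<epsilon>. \<Sum>n\<le>length ps. h (take n ps) (drop n ps))"
  proof (intro sum.cong refl)
    fix ps assume "ps \<in> tilings \<delta> \<epsilon>"
    with assms have "ps \<noteq> []" by (auto simp: tilings_def)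
    have "(\<Sum>n\<le>length ps. h (take n ps) (drop n ps)) =
        (\<Sum>n\<le>length ps. if n = 1 then weight q ps else 0)"
      by (intro sum.cong refl) (auto simp: h_def weight_append[symmetric])
    then show "weight q ps = (\<Sum>n\<le>length ps. h (take n ps) (drop n ps))"
      using \<open>ps \<noteq> []\<close> by (simp add: Suc_le_eq)
  qed
  also have "\<dots> = (\<Sum>i\<le>length \<delta>. \<Sum>k\<le>length \<epsilon>. \<Sum>ps\<in>tilings (take i \<delta>) (take k \<epsilon>).
      \<Sum>ps'\<in>tilings (drop i \<delta>) (drop k \<epsilon>). h ps ps')"
    by (rule sum_tilings_splits)
  also have "\<dots> = (\<Sum>i\<le>length \<delta>. \<Sum>k\<le>length \<epsilon>. tile_weight q i k *
      (\<Sum>ps\<in>tilings (drop i \<delta>) (drop k \<epsilon>). weight q ps))"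
  proof (intro sum.cong refl)
    fix i k assume ik: "i \<in> {..length \<delta>}" "k \<in> {..length \<epsilon>}"
    let ?p = "(take i \<delta>, take k \<epsilon>)"
    let ?W = "\<Sum>ps\<in>tilings (drop i \<delta>) (drop k \<epsilon>). weight q ps"
    have one: "ps = [?p] \<and> admissible ?p"
      if "ps \<in> tilings (take i \<delta>) (take k \<epsilon>)" "length ps = 1" for ps
      using that by (auto simp: tilings_def length_Suc_conv)
    have "(\<Sum>ps\<in>tilings (take i \<delta>) (take k \<epsilon>).
        \<Sum>ps'\<in>tilings (drop i \<delta>) (drop k \<epsilon>). h ps ps') =
        (\<Sum>ps\<in>tilings (take i \<delta>) (take k \<epsilon>). if ps = [?p] then weight q ps * ?W else 0)"
    proof (intro sum.cong refl)
      fix ps assume ps: "ps \<in> tilings (take i \<delta>) (take k \<epsilon>)"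
      show "(\<Sum>ps'\<in>tilings (drop i \<delta>) (drop k \<epsilon>). h ps ps') =
          (if ps = [?p] then weight q ps * ?W else 0)"
      proof (cases "length ps = 1")
        case True
        then show ?thesis
          using one[OF ps] by (simp add: h_def sum_distrib_left)
      next
        case False
        then have "ps \<noteq> [?p]" by auto
        with False show ?thesis by (simp add: h_def)
      qed
    qed
    also have "\<dots> = (if [?p] \<in> tilings (take i \<delta>) (take k \<epsilon>) then weight q [?p] * ?W else 0)"
      by simp
    also have "[?p] \<in> tilings (take i \<delta>) (take k \<epsilon>) \<longleftrightarrow> admissible ?p"
      by (simp add: tilings_def)
    also have "(if admissible ?p then weight q [?p] * ?W else 0) = tile_weight q i k * ?W"
      using ik by (auto simp: admissible_def tile_weight_def)
    finally show "(\<Sum>ps\<in>tilings (take i \<delta>) (take k \<epsilon>).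
        \<Sum>ps'\<in>tilings (drop i \<delta>) (drop k \<epsilon>). h ps ps') = tile_weight q i k * ?W" .
  qed
  finally show ?thesis .
qed

lemma sum_weight_tilings:
  "(\<Sum>ps\<in>tilings \<delta> \<epsilon>. weight q ps) = total_weight q (length \<delta>) (length \<epsilon>)"
proof (induction "length \<delta> + length \<epsilon>" arbitrary: \<delta> \<epsilon> rule: less_induct)
  case less
  show ?case
  proof (cases "\<delta> = [] \<and> \<epsilon> = []")
    case True
    then show ?thesis by (simp add: total_weight_def)
  next
    case False
    have "(\<Sum>ps\<in>tilings \<delta> \<epsilon>. weight q ps) =
        (\<Sum>i\<le>length \<delta>. \<Sum>k\<le>length \<epsilon>. tile_weight q i k *
          (\<Sum>ps\<in>tilings (drop i \<delta>) (drop k \<epsilon>). weight q ps))"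
      using False by (intro sum_weight_tilings_rec) auto
    also have "\<dots> = (\<Sum>i\<le>length \<delta>. \<Sum>k\<le>length \<epsilon>. tile_weight q i k *
        total_weight q (length \<delta> - i) (length \<epsilon> - k))"
    proof (intro sum.cong refl)
      fix i k assume "i \<in> {..length \<delta>}" "k \<in> {..length \<epsilon>}"
      then show "tile_weight q i k * (\<Sum>ps\<in>tilings (drop i \<delta>) (drop k \<epsilon>). weight q ps) =
          tile_weight q i k * total_weight q (length \<delta> - i) (length \<epsilon> - k)"
        using less[of "drop i \<delta>" "drop k \<epsilon>"] False by (cases "i = 0 \<and> k = 0") auto
    qed
    also have "\<dots> = total_weight q (length \<delta>) (length \<epsilon>)"
      using False by (auto simp: sum_tile_weight)
    finally show ?thesis .
  qed
qed

text \<open>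
  The identity behind the product formula: a variable of the product picks up \<open>q + 1\<close> once for a
  nonempty list of tiles on the right, but once from each factor that it meets on the left.
  The total weight compensates for the difference.
\<close>

lemma sum_weight_block_coef:
  "(\<Sum>ps\<in>tilings \<delta> \<epsilon>. weight q ps * block_coef q (length ps)) =
    block_coef q (length \<delta>) * block_coef q (length \<epsilon>)"
proof (cases "\<delta> = [] \<and> \<epsilon> = []")
  case True
  then show ?thesis by (simp add: block_coef_def)
next
  case False
  then have "(\<Sum>ps\<in>tilings \<delta> \<epsilon>. weight q ps * block_coef q (length ps)) =
      (\<Sum>ps\<in>tilings \<delta> \<epsilon>. weight q ps * (q + 1))"
    using tilings_eq_Nil_iff[of \<delta> \<epsilon>] by (intro sum.cong refl) (auto simp: block_coef_def)
  also have "\<dots> = total_weight q (length \<delta>) (length \<epsilon>) * (q + 1)"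
    by (simp only: sum_distrib_right[symmetric] sum_weight_tilings)
  finally show ?thesis
    using False by (auto simp: total_weight_def block_coef_def)
qed

section \<open>The product formula\<close>

definition tile_sums :: "(nat list \<times> nat list) list \<Rightarrow> nat list" where
  "tile_sums ps = map (\<lambda>(\<beta>, \<gamma>). sum_list \<beta> + sum_list \<gamma>) ps"

lemma sum_list_tile_sums:
  "sum_list (tile_sums ps) = sum_list (concat (map fst ps)) + sum_list (concat (map snd ps))"
  by (induction ps) (auto simp: tile_sums_def)

lemma composition_tile_sums:
  assumes "composition \<delta>" "composition \<epsilon>" "ps \<in> tilings \<delta> \<epsilon>"
  shows "composition (tile_sums ps)"
proof -
  have pos: "0 < sum_list (fst p) + sum_list (snd p)" if "p \<in> set ps" for p
  proof -
    have "set (fst p) \<subseteq> set \<delta>" "set (snd p) \<subseteq> set \<epsilon>"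
      using assms(3) that by (auto simp: tilings_def)
    then have "composition (fst p)" "composition (snd p)"
      using assms(1,2) by (auto simp: composition_def)
    moreover have "admissible p"
      using assms(3) that by (simp add: tilings_def)
    then have "fst p \<noteq> [] \<or> snd p \<noteq> []"
      by (auto simp: admissible_def)
    ultimately show ?thesis
      using composition_sum_eq_0 by (metis add_is_0 gr0I)
  qed
  show ?thesis
    unfolding composition_def tile_sums_def set_map case_prod_unfold
    by (intro ballI, elim imageE, simp only: pos)
qed

text \<open>
  Both sides satisfy the same recursion in the smallest variable. On the right, the tiles merged into
  the exponent \<open>c\<close> of that variable are an initial segment of the tiling, so the sum factors into the
  contribution of this segment, evaluated by \<open>sum_weight_block_coef\<close>, and that of the remaining
  tiles, to which the induction hypothesis applies.
\<close>

lemma coef_eta_times_eq_sum_tilings: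
  fixes q :: "'a::{comm_ring, comm_monoid_mult}"
  assumes "composition \<delta>" "composition \<epsilon>"
  shows "coef (eta q \<delta> * eta q \<epsilon>) m =
    (\<Sum>ps\<in>tilings \<delta> \<epsilon>. weight q ps * coef (eta q (tile_sums ps)) m)"
  using assms
proof (induction m arbitrary: \<delta> \<epsilon> rule: monom_induct)
  case zero
  have "(\<Sum>ps\<in>tilings \<delta> \<epsilon>. weight q ps * coef (eta q (tile_sums ps)) 0) =
      (\<Sum>ps\<in>tilings \<delta> \<epsilon>. if ps = [] then 1 else 0)"
    using composition_tile_sums[OF zero]
    by (intro sum.cong refl) (auto simp: coef_eta_zero tile_sums_def)
  then show ?case
    using zero by (simp add: coef_eta_times_zero tilings_eq_Nil_iff)
next
  case (single_plus j c m)
  define h where "h ps ps' = (if sum_list (tile_sums ps) = c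
    then weight q ps * block_coef q (length ps) * (weight q ps' * coef (eta q (tile_sums ps')) m)
    else 0)" for ps ps'
  have "(\<Sum>ps\<in>tilings \<delta> \<epsilon>. weight q ps * coef (eta q (tile_sums ps)) (Poly_Mapping.single j c + m))
      = (\<Sum>ps\<in>tilings \<delta> \<epsilon>. \<Sum>n\<le>length ps. h (take n ps) (drop n ps))"
  proof (intro sum.cong refl)
    fix ps assume ps: "ps \<in> tilings \<delta> \<epsilon>"
    have len: "length (tile_sums ps) = length ps" by (simp add: tile_sums_def)
    have w: "weight q ps = weight q (take n ps) * weight q (drop n ps)" for n
      by (simp flip: weight_append)
    have "weight q ps * coef (eta q (tile_sums ps)) (Poly_Mapping.single j c + m) =
        (\<Sum>n\<le>length ps. if sum_list (take n (tile_sums ps)) = c then weight q ps *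
          (block_coef q n * coef (eta q (drop n (tile_sums ps))) m) else 0)"
      unfolding coef_eta_single_plus[OF composition_tile_sums[OF single_plus.prems ps]
          single_plus.hyps(2)] len sum_distrib_left
      by (intro sum.cong refl) simp
    also have "\<dots> = (\<Sum>n\<le>length ps. h (take n ps) (drop n ps))"
    proof (intro sum.cong refl)
      fix n assume n: "n \<in> {..length ps}"
      show "(if sum_list (take n (tile_sums ps)) = c then weight q ps *
          (block_coef q n * coef (eta q (drop n (tile_sums ps))) m) else 0) =
          h (take n ps) (drop n ps)"
        using n unfolding w[of n] by (simp add: h_def tile_sums_def take_map drop_map ac_simps)
    qed
    finally show "weight q ps * coef (eta q (tile_sums ps)) (Poly_Mapping.single j c + m) =
        (\<Sum>n\<le>length ps. h (take n ps) (drop n ps))" .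
  qed
  also have "\<dots> = (\<Sum>i\<le>length \<delta>. \<Sum>k\<le>length \<epsilon>. \<Sum>ps\<in>tilings (take i \<delta>) (take k \<epsilon>).
      \<Sum>ps'\<in>tilings (drop i \<delta>) (drop k \<epsilon>). h ps ps')"
    by (rule sum_tilings_splits)
  also have "\<dots> = (\<Sum>i\<le>length \<delta>. \<Sum>k\<le>length \<epsilon>.
      if sum_list (take i \<delta>) + sum_list (take k \<epsilon>) = c
      then block_coef q i * block_coef q k * coef (eta q (drop i \<delta>) * eta q (drop k \<epsilon>)) m
      else 0)"
  proof (intro sum.cong refl)
    fix i k assume ik: "i \<in> {..length \<delta>}" "k \<in> {..length \<epsilon>}"
    let ?T = "tilings (take i \<delta>) (take k \<epsilon>)" and ?T' = "tilings (drop i \<delta>) (drop k \<epsilon>)"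
    have s: "sum_list (tile_sums ps) = sum_list (take i \<delta>) + sum_list (take k \<epsilon>)"
      if "ps \<in> ?T" for ps
      using that by (simp add: sum_list_tile_sums tilings_def)
    have "(\<Sum>ps\<in>?T. \<Sum>ps'\<in>?T'. h ps ps') =
        (if sum_list (take i \<delta>) + sum_list (take k \<epsilon>) = c
         then (\<Sum>ps\<in>?T. weight q ps * block_coef q (length ps)) *
           (\<Sum>ps'\<in>?T'. weight q ps' * coef (eta q (tile_sums ps')) m)
         else 0)"
      by (simp add: h_def s sum_product)
    also have "(\<Sum>ps\<in>?T. weight q ps * block_coef q (length ps)) =
        block_coef q i * block_coef q k"
      using ik by (simp add: sum_weight_block_coef)
    also have "(\<Sum>ps'\<in>?T'. weight q ps' * coef (eta q (tile_sums ps')) m) =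
        coef (eta q (drop i \<delta>) * eta q (drop k \<epsilon>)) m"
      by (rule single_plus.IH[symmetric]) (intro composition_drop single_plus.prems)+
    finally show "(\<Sum>ps\<in>?T. \<Sum>ps'\<in>?T'. h ps ps') =
        (if sum_list (take i \<delta>) + sum_list (take k \<epsilon>) = c
         then block_coef q i * block_coef q k * coef (eta q (drop i \<delta>) * eta q (drop k \<epsilon>)) m
         else 0)" .
  qed
  also have "\<dots> = coef (eta q \<delta> * eta q \<epsilon>) (Poly_Mapping.single j c + m)"
    by (rule coef_eta_times_single_plus[OF single_plus.prems single_plus.hyps(2), symmetric])
  finally show ?case by (rule sym)
qed

text \<open>
  An admissible tile has \<open>max (length \<beta>) (length \<gamma>) \<ge> 1\<close>, so the truncated differences of the
  single tiles add up to the truncated difference of the totals.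
\<close>

lemma weight_eq:
  assumes "\<forall>p\<in>set ps. admissible p"
  shows "weight q ps =
    (- q) ^ ((\<Sum>s<length ps. max (length (fst (ps ! s))) (length (snd (ps ! s)))) - length ps) *
    (q - 1) ^ card {s. s < length ps \<and> length (fst (ps ! s)) = length (snd (ps ! s))}"
proof -
  let ?max = "\<lambda>p. max (length (fst p)) (length (snd p))"
  let ?P = "\<lambda>p. length (fst p) = length (snd p)"
  have "length ps \<le> sum_list (map ?max ps) \<and>
      weight q ps = (- q) ^ (sum_list (map ?max ps) - length ps) * (q - 1) ^ length (filter ?P ps)"
    using assms
  proof (induction ps)
    case (Cons p ps)
    obtain \<beta> \<gamma> where p: "p = (\<beta>, \<gamma>)" by fastforce
    have adm: "\<bar>int (length \<beta>) - int (length \<gamma>)\<bar> \<le> 1" "0 < length \<beta> + length \<gamma>"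
      using Cons.prems by (auto simp: p admissible_def)
    then have max: "1 \<le> ?max p" unfolding p fst_conv snd_conv by linarith
    have "\<forall>p\<in>set ps. admissible p"
      using Cons.prems by simp
    note IH = conjunct1[OF Cons.IH[OF this]] conjunct2[OF Cons.IH[OF this]]
    have exp: "sum_list (map ?max (p # ps)) - length (p # ps) =
        (?max p - 1) + (sum_list (map ?max ps) - length ps)"
      unfolding list.map sum_list.Cons list.size using IH(1) max by linarith
    have "weight q (p # ps) = (- q) ^ (?max p - 1) * (if ?P p then q - 1 else 1) * weight q ps"
      using adm by (simp add: p tile_weight_def)
    then have "weight q (p # ps) = (- q) ^ (sum_list (map ?max (p # ps)) - length (p # ps)) *
        (q - 1) ^ length (filter ?P (p # ps))"
      unfolding IH(2) exp power_add by (cases "?P p") (simp_all add: ac_simps)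
    moreover have "length (p # ps) \<le> sum_list (map ?max (p # ps))"
      unfolding list.map sum_list.Cons list.size using IH(1) max by linarith
    ultimately show ?case by blast
  qed simp
  then show ?thesis
    by (simp add: sum_list_sum_nth atLeast0LessThan length_filter_conv_card)
qed

lemma sum_factorizations_eq_sum_tilings:
  fixes q :: "'a::{comm_ring, comm_monoid_mult}"
  assumes "composition \<delta>" and "composition \<epsilon>"
  shows "(\<Sum>(k, \<beta>s, \<gamma>s) \<in> factorizations \<delta> \<epsilon>.
      ((- q) ^ ((\<Sum>s<k. max (length (\<beta>s ! s)) (length (\<gamma>s ! s))) - k) *
       (q - 1) ^ card {s. s < k \<and> length (\<beta>s ! s) = length (\<gamma>s ! s)})
      \<cdot> eta q (map (\<lambda>s. sum_list (\<beta>s ! s) + sum_list (\<gamma>s ! s)) [0..<k])) =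
    (\<Sum>ps\<in>tilings \<delta> \<epsilon>. weight q ps \<cdot> eta q (tile_sums ps))"
proof (rule sum.reindex_bij_witness[symmetric, where
    j = "\<lambda>ps. (length ps, map fst ps, map snd ps)" and i = "\<lambda>(k, \<beta>s, \<gamma>s). zip \<beta>s \<gamma>s"], goal_cases)
  case (1 ps)
  then show ?case by (simp add: zip_map_fst_snd)
next
  case (2 ps)
  have "composition (fst p)" "composition (snd p)" if "p \<in> set ps" for p
    using 2 assms that by (auto simp: tilings_def composition_def)
  with 2 show ?case
    by (auto simp: factorizations_def tilings_def admissible_def case_prod_unfold
        simp del: add_gr_0 length_greater_0_conv)
next
  case (3 x)
  then show ?case by (auto simp: factorizations_def)
next
  case (4 x)
  then show ?case by (auto simp: factorizations_def tilings_def admissible_def set_zip)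
next
  case (5 ps)
  have "tile_sums ps = map (\<lambda>s. sum_list (map fst ps ! s) + sum_list (map snd ps ! s)) [0..<length ps]"
    by (rule nth_equalityI) (auto simp: tile_sums_def case_prod_unfold)
  moreover have "(\<Sum>s<length ps. max (length (map fst ps ! s)) (length (map snd ps ! s))) =
      (\<Sum>s<length ps. max (length (fst (ps ! s))) (length (snd (ps ! s))))"
    by (intro sum.cong) auto
  moreover have "{s. s < length ps \<and> length (map fst ps ! s) = length (map snd ps ! s)} =
      {s. s < length ps \<and> length (fst (ps ! s)) = length (snd (ps ! s))}"
    by auto
  moreover have "\<forall>p\<in>set ps. admissible p"
    using 5 by (simp add: tilings_def)
  ultimately show ?case
    by (simp only: weight_eq prod.case)
qed

theorem theorem5p1:
  fixes q :: "'a::{comm_ring, comm_monoid_mult}"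
    and \<delta> \<epsilon> :: "nat list"
  assumes "composition \<delta>" and "composition \<epsilon>"
  shows "eta q \<delta> * eta q \<epsilon> =
    (\<Sum>(k, \<beta>s, \<gamma>s) \<in> factorizations \<delta> \<epsilon>.
      ((- q) ^ ((\<Sum>s<k. max (length (\<beta>s ! s)) (length (\<gamma>s ! s))) - k) *
       (q - 1) ^ card {s. s < k \<and> length (\<beta>s ! s) = length (\<gamma>s ! s)})
      \<cdot> eta q (map (\<lambda>s. sum_list (\<beta>s ! s) + sum_list (\<gamma>s ! s)) [0..<k]))"
proof -
  have "eta q \<delta> * eta q \<epsilon> = (\<Sum>ps\<in>tilings \<delta> \<epsilon>. weight q ps \<cdot> eta q (tile_sums ps))"
    by (rule mpseries_eqI) (simp add: coef_eta_times_eq_sum_tilings[OF assms])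
  then show ?thesis
    by (simp only: sum_factorizations_eq_sum_tilings[OF assms])
qed

end
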